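(* Let $m\ge 1$ be an integer, and let $R_{m,1}$ be the maximal positive root of the equation $\varphi_m(r)=0$, where $$\varphi_m(r)=(1-r)(r^{2m}+2r^m-1)+2r^2(1+r^m)^2 .$$ Then for every $f\in\mathcal{B}$ with power series $f(z)=\sum_{k=0}^\infty a_k z^k$, $$|f(z^m)|+|z^m|\,|f'(z^m)| +\sum_{k=2}^\infty |a_k|r^k \le 1\quad\text{for all } z\in\mathbb{D} \text{ with } |z|=r \le R_{m,1}.$$ Moreover, the constant $R_{m,1}$ cannot be improved, i.e. it cannot be replaced by any larger number: for every $R'\in(R_{m,1},1)$ there exist $f\in\mathcal{B}$ and $z$ with $|z|=r\le R'$ for which the left-hand side is greater than $1$.
   Context: $\mathbb{D}=\{z\in\mathbb{C}: |z|<1\}$, and $\mathcal{B}$ is the set of analytic functions $f$ in $\mathbb{D}$ with $|f(z)|<1$ for all $z\in\mathbb{D}$. *)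

theory Defs
  imports "HOL-Complex_Analysis.Complex_Analysis"
begin

definition schur_class :: "(complex \<Rightarrow> complex) set" where
  "schur_class = {f. f holomorphic_on ball 0 1 \<and> (\<forall>z\<in>ball 0 1. norm (f z) < 1)}"

definition has_power_series :: "(complex \<Rightarrow> complex) \<Rightarrow> (nat \<Rightarrow> complex) \<Rightarrow> bool" where
  "has_power_series f a \<longleftrightarrow> (\<forall>z\<in>ball 0 1. (\<lambda>k. a k * z ^ k) sums f z)"

definition phi :: "nat \<Rightarrow> real \<Rightarrow> real" where
  "phi m r = (1 - r) * (r ^ (2 * m) + 2 * r ^ m - 1) + 2 * r\<^sup>2 * (1 + r ^ m)\<^sup>2"

definition R_m1 :: "nat \<Rightarrow> real" where
  "R_m1 m = (GREATEST r. 0 < r \<and> phi m r = 0)"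

lemma phi_eq: "phi m r = (1 + r ^ m)\<^sup>2 * (1 - r + 2 * r\<^sup>2) - 2 * (1 - r)"
proof -
  have *: "(1 - r) * (x\<^sup>2 + 2 * x - 1) + 2 * r\<^sup>2 * (1 + x)\<^sup>2 =
      (1 + x)\<^sup>2 * (1 - r + 2 * r\<^sup>2) - 2 * (1 - r)" for x :: real
    by (simp add: power2_eq_square algebra_simps)
  show ?thesis
    unfolding phi_def power_even_eq by (rule *)
qed

lemma R_m1_greatest_root:
  assumes "m \<ge> 1"
  shows "0 < R_m1 m" "R_m1 m < 1" "phi m (R_m1 m) = 0"
    and "\<And>r. 0 < r \<Longrightarrow> phi m r = 0 \<Longrightarrow> r \<le> R_m1 m"
proof -
  let ?S = "{r \<in> {0..1}. phi m r = 0}"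
  have cont: "continuous_on {0..1} (phi m)"
    unfolding phi_def by (intro continuous_intros)
  have at0: "phi m 0 = -1"
    using assms by (simp add: phi_def power_0_left)
  have at1: "phi m 1 = 8"
    by (simp add: phi_def)
  have big: "phi m r > 0" if "r \<ge> 1" for r
  proof -
    have "r \<le> r\<^sup>2"
      using that by (simp add: power2_eq_square)
    then have "1 - r + 2 * r\<^sup>2 > 0"
      using that by linarith
    moreover have "1 + r ^ m > 0"
      using that by (simp add: add_pos_nonneg)
    ultimately have "(1 + r ^ m)\<^sup>2 * (1 - r + 2 * r\<^sup>2) > 0"
      by simp
    then show ?thesis
      using that by (simp add: phi_eq)
  qed
  have "\<exists>r\<ge>0. r \<le> 1 \<and> phi m r = 0"
    by (rule IVT') (use at0 at1 cont in auto)
  then have "?S \<noteq> {}"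
    by auto
  moreover have "compact ?S"
    unfolding compact_eq_bounded_closed
  proof
    show "bounded ?S"
      by (rule bounded_subset[of "{0..1}"]) auto
    show "closed ?S"
      using continuous_closed_preimage_constant[OF cont, of 0] by simp
  qed
  ultimately obtain s where s: "s \<in> ?S" "\<forall>t\<in>?S. t \<le> s"
    using compact_attains_sup[of ?S] by blast
  have "s \<noteq> 0" "s \<noteq> 1"
    using s(1) at0 at1 by auto
  then have s01: "0 < s" "s < 1" "phi m s = 0"
    using s(1) by auto
  have max: "r \<le> s" if "0 < r" "phi m r = 0" for r
    using that s(2) big[of r] by (cases "r \<le> 1") auto
  have "R_m1 m = s"
    unfolding R_m1_def by (rule Greatest_equality) (use s01 max in auto)
  then show "0 < R_m1 m" "R_m1 m < 1" "phi m (R_m1 m) = 0"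
    and "\<And>r. 0 < r \<Longrightarrow> phi m r = 0 \<Longrightarrow> r \<le> R_m1 m"
    using s01 max by auto
qed

end

theory Submission
  imports Defs
begin

text \<open>
  Put \<rho> = r^m, a = |f 0| and x = |f(z^m)|. By Schwarz--Pick, x + \<rho> |f'(z^m)| is at most
  x + \<rho> (1 - x^2) / (1 - \<rho>^2), which increases in x on [0, 1] because the defining equation of
  the radius forces \<rho>^2 + 2 \<rho> \<le> 1; so x may be replaced by its largest value
  (\<rho> + a) / (1 + a \<rho>). The remaining series is bounded by (1 - a^2) r^2 / (1 - r), since
  |a_k| \<le> 1 - a^2. After division by 1 - a the resulting inequality is tightest at a = 1, where it
  says that phi m r \<le> 0. The functions (z + a) / (1 + a z) with a close to 1 show sharpness.
\<close>

section \<open>Schwarz--Pick estimates\<close>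

lemma one_minus_cnj_mult_nonzero:
  assumes "norm w < 1" "norm z < 1"
  shows "1 - cnj w * z \<noteq> 0"
proof
  assume "1 - cnj w * z = 0"
  then have "norm (cnj w * z) = 1"
    by (metis eq_iff_diff_eq_0 norm_one)
  moreover have "norm (cnj w * z) < 1"
    using norm_mult_less[of "cnj w" 1 z 1] assms by simp
  ultimately show False
    by simp
qed

text \<open>Clearing denominators leaves |1 - cnj w z|^2 - |z - w|^2 = (1 - |w|^2) (1 - |z|^2),
  checked in real and imaginary parts. It lets a Schwarz bound on the Moebius image be read as an
  inequality between moduli.\<close>

lemma one_minus_norm_Moebius_function:
  assumes "norm w < 1" "norm z < 1"
  shows "(1 - (norm (Moebius_function 0 w z))\<^sup>2) * (norm (1 - cnj w * z))\<^sup>2 =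
    (1 - (norm w)\<^sup>2) * (1 - (norm z)\<^sup>2)"
proof -
  have "norm (1 - cnj w * z) \<noteq> 0"
    using one_minus_cnj_mult_nonzero[OF assms] by simp
  then have "(1 - (norm (Moebius_function 0 w z))\<^sup>2) * (norm (1 - cnj w * z))\<^sup>2 =
      (norm (1 - cnj w * z))\<^sup>2 - (norm (z - w))\<^sup>2"
    by (simp add: Moebius_function_simple norm_divide power_divide left_diff_distrib)
  also have "\<dots> = (1 - (norm w)\<^sup>2) * (1 - (norm z)\<^sup>2)"
    by (simp add: cmod_power2) (simp add: power2_eq_square algebra_simps)
  finally show ?thesis .
qed

text \<open>The numerator of the quotient rule collapses to \<open>1 - w * cnj w\<close>. The
  Schwarz--Pick bounds use the points z = w and z = 0, the extremal function uses z =
  \<rho>.\<close>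

lemma Moebius_function_has_field_derivative:
  assumes "norm w < 1" "norm z < 1"
  shows "(Moebius_function 0 w has_field_derivative
    of_real (1 - (norm w)\<^sup>2) / (1 - cnj w * z)\<^sup>2) (at z)"
proof -
  have nz: "1 - cnj w * z \<noteq> 0"
    by (rule one_minus_cnj_mult_nonzero[OF assms])
  have "w * cnj w = of_real ((norm w)\<^sup>2)"
    by (simp add: complex_norm_square del: of_real_power)
  then have "(1 - cnj w * z) - (z - w) * (- cnj w) = of_real (1 - (norm w)\<^sup>2)"
    by (simp add: algebra_simps)
  moreover have "(Moebius_function 0 w has_field_derivative
      ((1 - cnj w * z) - (z - w) * (- cnj w)) / ((1 - cnj w * z) * (1 - cnj w * z))) (at z)"
    unfolding Moebius_function_simple[abs_def]
    by (rule derivative_eq_intros refl nz | simp)+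
  ultimately show ?thesis
    by (simp only: power2_eq_square)
qed

lemma schur_class_Moebius_function:
  assumes "norm w < 1"
  shows "Moebius_function 0 w \<in> schur_class"
  using Moebius_function_holomorphic[OF assms] Moebius_function_norm_lt_1[OF assms]
  by (auto simp: schur_class_def)

lemma schur_class_compose:
  assumes "f \<in> schur_class" "g \<in> schur_class"
  shows "f \<circ> g \<in> schur_class"
  using assms by (auto simp: schur_class_def intro!: holomorphic_on_compose_gen)

lemma schur_class_norm_less:
  assumes "f \<in> schur_class" "norm z < 1"
  shows "norm (f z) < 1"
  using assms by (auto simp: schur_class_def)

lemma schur_class_has_deriv:
  assumes "f \<in> schur_class" "norm z < 1"
  shows "(f has_field_derivative deriv f z) (at z)"
  using assms by (auto simp: schur_class_def intro!: holomorphic_derivI[of f "ball 0 1"])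

text \<open>Following \<open>f\<close> by the automorphism that sends \<open>f 0\<close> to 0 gives
  a map fixing 0, whose derivative there has modulus at most 1 by the Schwarz lemma. The chain rule
  then isolates \<open>deriv f 0\<close>.\<close>

lemma schur_class_deriv_0_le:
  assumes f: "f \<in> schur_class"
  shows "norm (deriv f 0) \<le> 1 - (norm (f 0))\<^sup>2"
proof -
  let ?M = "Moebius_function 0 (f 0)"
  have f0: "norm (f 0) < 1"
    by (rule schur_class_norm_less[OF f]) simp
  then have pos: "1 - (norm (f 0))\<^sup>2 > 0"
    by (simp add: abs_square_less_1)
  have Mf: "?M \<circ> f \<in> schur_class"
    by (intro schur_class_compose schur_class_Moebius_function f f0)
  have sq: "cnj (f 0) * f 0 = of_real ((norm (f 0))\<^sup>2)"
    by (simp add: complex_norm_square mult.commute del: of_real_power)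
  \<comment> \<open>At the point \<open>f 0\<close> itself the numerator cancels one of the two
    powers in the denominator.\<close>
  have eq: "of_real (1 - (norm (f 0))\<^sup>2) / (1 - cnj (f 0) * f 0)\<^sup>2 =
      of_real (1 / (1 - (norm (f 0))\<^sup>2))"
  proof -
    have "1 - cnj (f 0) * f 0 = of_real (1 - (norm (f 0))\<^sup>2)"
      using sq by simp
    then show ?thesis
      using pos by (simp add: power2_eq_square del: of_real_diff of_real_power)
  qed
  have "(?M \<circ> f has_field_derivative of_real (1 / (1 - (norm (f 0))\<^sup>2)) * deriv f 0) (at 0)"
    using DERIV_chain[OF Moebius_function_has_field_derivative[OF f0 f0]
        schur_class_has_deriv[OF f, of 0]]
    unfolding eq by simp
  then have "deriv (?M \<circ> f) 0 = of_real (1 / (1 - (norm (f 0))\<^sup>2)) * deriv f 0"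
    by (rule DERIV_imp_deriv)
  moreover have "norm (deriv (?M \<circ> f) 0) \<le> 1"
    by (rule Schwarz_Lemma(2)[where \<xi> = 0])
      (use Mf in \<open>auto simp: schur_class_def Moebius_function_eq_zero\<close>)
  ultimately have "1 / (1 - (norm (f 0))\<^sup>2) * norm (deriv f 0) \<le> 1"
    using pos by (simp add: norm_mult del: of_real_divide of_real_diff of_real_power)
  then show ?thesis
    using pos by (simp add: field_simps)
qed

text \<open>Preceding \<open>f\<close> by the automorphism that takes 0 to \<open>w\<close> moves
  the estimate to the origin; that automorphism has derivative 1 - |w|^2 at 0.\<close>

lemma Schwarz_Pick_deriv:
  assumes f: "f \<in> schur_class" and w: "norm w < 1"
  shows "norm (deriv f w) * (1 - (norm w)\<^sup>2) \<le> 1 - (norm (f w))\<^sup>2"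
proof -
  let ?M = "Moebius_function 0 (- w)"
  have M0: "?M 0 = w"
    by (simp add: Moebius_function_of_zero)
  have pos: "1 - (norm w)\<^sup>2 > 0"
    using w by (simp add: abs_square_less_1)
  have "f \<circ> ?M \<in> schur_class"
    using w by (intro schur_class_compose schur_class_Moebius_function f) simp
  then have *: "norm (deriv (f \<circ> ?M) 0) \<le> 1 - (norm ((f \<circ> ?M) 0))\<^sup>2"
    by (rule schur_class_deriv_0_le)
  have "(?M has_field_derivative of_real (1 - (norm w)\<^sup>2)) (at 0)"
    using Moebius_function_has_field_derivative[of "- w" 0] w by simp
  moreover have "(f has_field_derivative deriv f w) (at (?M 0))"
    unfolding M0 by (rule schur_class_has_deriv[OF f w])
  ultimately have "(f \<circ> ?M has_field_derivative deriv f w * of_real (1 - (norm w)\<^sup>2)) (at 0)"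
    by (intro DERIV_chain)
  then have "deriv (f \<circ> ?M) 0 = deriv f w * of_real (1 - (norm w)\<^sup>2)"
    by (rule DERIV_imp_deriv)
  then have "norm (deriv (f \<circ> ?M) 0) = norm (deriv f w) * (1 - (norm w)\<^sup>2)"
    using pos by (simp add: norm_mult del: of_real_diff of_real_power)
  then show ?thesis
    using * by (simp add: M0)
qed

text \<open>The Schwarz lemma for \<open>?M \<circ> f\<close>, which fixes 0, bounds |M(f w)| by
  |w|. The rest eliminates the arguments of \<open>f 0\<close> and \<open>f w\<close> and solves for
  the modulus of \<open>f w\<close>.\<close>

lemma schur_class_growth:
  assumes f: "f \<in> schur_class" and w: "norm w < 1"
  shows "norm (f w) \<le> (norm w + norm (f 0)) / (1 + norm (f 0) * norm w)"
proof -
  define a x \<rho> where "a = norm (f 0)" and "x = norm (f w)" and "\<rho> = norm w"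
  let ?M = "Moebius_function 0 (f 0)"
  have f0: "norm (f 0) < 1" and fw: "norm (f w) < 1"
    using schur_class_norm_less[OF f] w by auto
  have nonneg: "0 \<le> a" "0 \<le> x" "0 \<le> \<rho>" "\<rho> < 1" "a < 1" "x < 1"
    using f0 fw w by (auto simp: a_def x_def \<rho>_def)
  have ax: "a * x < 1"
    using mult_strict_mono[of a 1 x 1] nonneg by auto
  have "?M \<circ> f \<in> schur_class"
    by (intro schur_class_compose schur_class_Moebius_function f f0)
  then have "norm ((?M \<circ> f) w) \<le> norm w"
    by (intro Schwarz_Lemma(1)) (use w in \<open>auto simp: schur_class_def Moebius_function_eq_zero o_def\<close>)
  then have "(norm (?M (f w)))\<^sup>2 \<le> \<rho>\<^sup>2"
    by (simp add: \<rho>_def power_mono)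
  moreover have "1 - a * x \<le> norm (1 - cnj (f 0) * f w)"
    using norm_triangle_ineq2[of 1 "cnj (f 0) * f w"] by (simp add: norm_mult a_def x_def)
  then have "(1 - a * x)\<^sup>2 \<le> (norm (1 - cnj (f 0) * f w))\<^sup>2"
    using ax by (intro power_mono) auto
  moreover have "1 - \<rho>\<^sup>2 \<ge> 0"
    using nonneg by (simp add: abs_square_le_1)
  ultimately have "(1 - \<rho>\<^sup>2) * (1 - a * x)\<^sup>2 \<le>
      (1 - (norm (?M (f w)))\<^sup>2) * (norm (1 - cnj (f 0) * f w))\<^sup>2"
    by (intro mult_mono) auto
  also have "\<dots> = (1 - a\<^sup>2) * (1 - x\<^sup>2)"
    unfolding a_def x_def by (rule one_minus_norm_Moebius_function[OF f0 fw])
  \<comment> \<open>This uses (1 - a x)^2 - (x - a)^2 = (1 - a^2) (1 - x^2).\<close>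
  finally have "(x - a)\<^sup>2 \<le> (\<rho> * (1 - a * x))\<^sup>2"
    by (simp add: power2_eq_square algebra_simps)
  then have "x - a \<le> \<rho> * (1 - a * x)"
    by (rule power2_le_imp_le) (use nonneg ax in auto)
  moreover have "1 + a * \<rho> > 0"
    using nonneg by (simp add: add_pos_nonneg)
  ultimately have "x \<le> (\<rho> + a) / (1 + a * \<rho>)"
    by (simp add: field_simps)
  then show ?thesis
    by (simp add: a_def x_def \<rho>_def)
qed

section \<open>Coefficient bound\<close>

lemma has_power_series_0:
  assumes "has_power_series f a"
  shows "f 0 = a 0"
proof -
  have "(\<lambda>k. a k * 0 ^ k) sums f 0"
    using assms unfolding has_power_series_def by (rule bspec) simp
  then show ?thesis
    using powser_sums_zero[of a] sums_unique2 by blast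
qed

text \<open>Termwise differentiation concerns the function defined by the series; the result passes
  to \<open>f\<close> because the two agree on the disc, hence near \<open>z\<close>.\<close>

lemma has_power_series_has_field_derivative:
  assumes "has_power_series f a" "norm z < 1"
  shows "(f has_field_derivative (\<Sum>n. diffs a n * z ^ n)) (at z)"
proof -
  have sums: "(\<lambda>k. a k * w ^ k) sums f w" if "norm w < 1" for w
    using assms that by (simp add: has_power_series_def)
  have "((\<lambda>w. \<Sum>n. a n * w ^ n) has_field_derivative (\<Sum>n. diffs a n * z ^ n)) (at z)"
    by (rule termdiffs_strong'[of 1]) (use sums assms in \<open>auto simp: sums_iff\<close>)
  moreover have "eventually (\<lambda>w. w \<in> ball 0 1) (nhds z)"
    using assms by (intro eventually_nhds_in_open) auto
  then have "eventually (\<lambda>w. (\<Sum>n. a n * w ^ n) = f w) (nhds z)"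
    by eventually_elim (use sums in \<open>auto simp: sums_iff\<close>)
  ultimately show ?thesis
    by (subst (asm) DERIV_cong_ev[OF refl _ refl])
qed

text \<open>If k divides n every summand is 1. Otherwise the ratio of the geometric sum is a k-th
  root of unity other than 1, so the sum vanishes.\<close>

lemma sum_root_unity_power:
  assumes "1 \<le> k"
  shows "(\<Sum>j<k. (exp (2 * of_real pi * \<i> / of_nat k) ^ n) ^ j) = (if k dvd n then of_nat k else 0)"
proof -
  define \<omega> where "\<omega> = exp (2 * of_real pi * \<i> / of_nat k)"
  have pow: "\<omega> ^ n = exp (2 * of_real pi * \<i> * of_nat n / of_nat k)" for n
    by (simp add: \<omega>_def exp_of_nat_mult[symmetric] mult_ac)
  have eq1: "\<omega> ^ n = 1 \<longleftrightarrow> k dvd n" for n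
    unfolding pow by (rule complex_root_unity_eq_1[OF assms])
  have "(\<Sum>j<k. (\<omega> ^ n) ^ j) = (if k dvd n then of_nat k else 0)"
  proof (cases "k dvd n")
    case True
    then show ?thesis
      using eq1[of n] by simp
  next
    case False
    have "(\<omega> ^ n) ^ k = (\<omega> ^ k) ^ n"
      by (simp add: mult.commute flip: power_mult)
    then show ?thesis
      using False eq1[of n] eq1[of k] by (simp add: geometric_sum)
  qed
  then show ?thesis
    by (simp add: \<omega>_def)
qed

text \<open>Averaging f over the rotations by the k-th roots of unity keeps exactly the coefficients whose
  index is divisible by k, and an average of values in the disc stays in the disc.\<close>

lemma schur_class_multisection:
  assumes f: "f \<in> schur_class" and a: "has_power_series f a" and k: "1 \<le> k"
  obtains g where "g \<in> schur_class" "has_power_series g (\<lambda>n. a (k * n))"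
proof -
  define \<omega> where "\<omega> = exp (2 * of_real pi * \<i> / of_nat k)"
  have norm_\<omega>: "norm \<omega> = 1"
    by (simp add: \<omega>_def norm_exp_eq_Re)
  define F where "F z = (\<Sum>j<k. f (\<omega> ^ j * z)) / of_nat k" for z
  have F_sums: "(\<lambda>n. a (k * n) * (z ^ k) ^ n) sums F z" if z: "norm z < 1" for z
  proof -
    have "(\<lambda>n. a n * (\<omega> ^ j * z) ^ n) sums f (\<omega> ^ j * z)" for j
      using a z by (simp add: has_power_series_def norm_mult norm_power norm_\<omega>)
    then have "(\<lambda>n. (\<Sum>j<k. a n * (\<omega> ^ j * z) ^ n) / of_nat k) sums F z"
      unfolding F_def by (intro sums_divide sums_sum)
    moreover have "(\<Sum>j<k. a n * (\<omega> ^ j * z) ^ n) / of_nat k =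
        (if k dvd n then a n * z ^ n else 0)" for n
    proof -
      have "(\<Sum>j<k. a n * (\<omega> ^ j * z) ^ n) = a n * z ^ n * (\<Sum>j<k. (\<omega> ^ n) ^ j)"
        by (simp add: sum_distrib_left power_mult_distrib mult_ac flip: power_mult)
      then show ?thesis
        using k by (simp add: sum_root_unity_power \<omega>_def)
    qed
    ultimately have "(\<lambda>n. if k dvd n then a n * z ^ n else 0) sums F z"
      by simp
    \<comment> \<open>All nonzero terms sit at multiples of k, so summing over those indices alone
      gives the same value and exhibits \<open>F\<close> as a power series in z^k.\<close>
    then have "(\<lambda>n. if k dvd k * n then a (k * n) * z ^ (k * n) else 0) sums F z"
      by (subst sums_mono_reindex[where g = "\<lambda>n. k * n"])
        (use k in \<open>auto simp: strict_mono_def\<close>)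
    then show ?thesis
      by (simp add: power_mult)
  qed
  have F_norm: "norm (F z) < 1" if "norm z < 1" for z
  proof -
    have "norm (\<Sum>j<k. f (\<omega> ^ j * z)) \<le> (\<Sum>j<k. norm (f (\<omega> ^ j * z)))"
      by (rule norm_sum)
    also have "\<dots> < (\<Sum>j<k. 1)"
      using k that
      by (intro sum_strict_mono schur_class_norm_less[OF f])
        (auto simp: norm_mult norm_power norm_\<omega> lessThan_empty_iff)
    finally show ?thesis
      using k by (simp add: F_def norm_divide divide_simps)
  qed
  \<comment> \<open>This is the series of \<open>F\<close> in the new variable w = z^k, so that
    g(z^k) = F(z).\<close>
  define g where "g w = (\<Sum>n. a (k * n) * w ^ n)" for w
  have root: "\<exists>z. norm z < 1 \<and> z ^ k = w" if "norm w < 1" for w :: complex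
  proof -
    obtain z where z: "z ^ k = w"
      using exists_complex_root[of k w] k by (metis not_one_le_zero)
    have "norm z < 1"
    proof (rule ccontr)
      assume "\<not> norm z < 1"
      then have "1 \<le> norm z ^ k"
        by (intro one_le_power) simp
      then show False
        using that z by (simp add: norm_power[symmetric])
    qed
    then show ?thesis
      using z by blast
  qed
  \<comment> \<open>Each w in the disc has a k-th root z in the disc, so convergence and the bound
    pass from \<open>F\<close> to \<open>g\<close>.\<close>
  have g_sums: "(\<lambda>n. a (k * n) * w ^ n) sums g w" "norm (g w) < 1" if "norm w < 1" for w
  proof -
    obtain z where z: "norm z < 1" "z ^ k = w"
      using root \<open>norm w < 1\<close> by blast
    have "(\<lambda>n. a (k * n) * w ^ n) sums F z"
      using F_sums[OF z(1)] z(2) by simp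
    moreover from this have "g w = F z"
      by (simp add: g_def sums_iff)
    ultimately show "(\<lambda>n. a (k * n) * w ^ n) sums g w" "norm (g w) < 1"
      using F_norm[OF z(1)] by auto
  qed
  have ps: "has_power_series g (\<lambda>n. a (k * n))"
    using g_sums(1) by (simp add: has_power_series_def)
  have "g holomorphic_on ball 0 1"
    unfolding holomorphic_on_open[OF open_ball]
    using has_power_series_has_field_derivative[OF ps] by (metis mem_ball_0)
  then have "g \<in> schur_class"
    using g_sums(2) by (simp add: schur_class_def)
  then show ?thesis
    using ps that by blast
qed

text \<open>Multisection turns \<open>a k\<close> into the first coefficient of a function of the
  same class with the same constant term, so the derivative bound at 0 applies.\<close>

lemma schur_class_coeff_le:
  assumes f: "f \<in> schur_class" and a: "has_power_series f a" and k: "1 \<le> k"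
  shows "norm (a k) \<le> 1 - (norm (a 0))\<^sup>2"
proof -
  obtain g where g: "g \<in> schur_class" and ps: "has_power_series g (\<lambda>n. a (k * n))"
    using schur_class_multisection[OF assms] .
  have "deriv g 0 = (\<Sum>n. diffs (\<lambda>n. a (k * n)) n * 0 ^ n)"
    using has_power_series_has_field_derivative[OF ps, of 0] by (intro DERIV_imp_deriv) simp
  also have "\<dots> = a k"
    by (simp add: powser_zero diffs_def)
  finally show ?thesis
    using schur_class_deriv_0_le[OF g] has_power_series_0[OF ps] by simp
qed

section \<open>The radius\<close>

text \<open>This form separates the monotone pieces: for r in [0, 1] the left side increases while
  each factor on the right decreases. It is also the form in which the radius enters the real
  inequality.\<close>

lemma phi_nonpos_iff:
  "phi m r \<le> 0 \<longleftrightarrow>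
    2 * r\<^sup>2 * (1 + r ^ m)\<^sup>2 \<le> (1 - r) * (1 - 2 * r ^ m - (r ^ m)\<^sup>2)"
proof -
  have "phi m r = 2 * r\<^sup>2 * (1 + r ^ m)\<^sup>2 - (1 - r) * (1 - 2 * r ^ m - (r ^ m)\<^sup>2)"
    unfolding phi_def power_even_eq by (simp add: algebra_simps)
  then show ?thesis
    by simp
qed

text \<open>The comparison holds at the root R; going down from R to r lowers the left side and
  raises the right side.\<close>

lemma phi_nonpos:
  assumes "m \<ge> 1" "0 \<le> r" "r \<le> R_m1 m"
  shows "phi m r \<le> 0"
proof -
  define R where "R = R_m1 m"
  have R: "0 < R" "R < 1" "phi m R = 0"
    using R_m1_greatest_root[OF assms(1)] by (auto simp: R_def)
  have r: "0 \<le> r" "r \<le> R" "r ^ m \<le> R ^ m" "0 \<le> r ^ m"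
    using assms by (auto simp: R_def power_mono)
  have "2 * R\<^sup>2 * (1 + R ^ m)\<^sup>2 \<le> (1 - R) * (1 - 2 * R ^ m - (R ^ m)\<^sup>2)"
    using R phi_nonpos_iff[of m R] by simp
  moreover from this have "0 \<le> (1 - R) * (1 - 2 * R ^ m - (R ^ m)\<^sup>2)"
    by (rule order_trans[rotated]) simp
  \<comment> \<open>This sign is what makes the product of the two decreasing factors
    monotone.\<close>
  then have "0 \<le> 1 - 2 * R ^ m - (R ^ m)\<^sup>2"
    using R by (simp add: zero_le_mult_iff)
  moreover have "(r ^ m)\<^sup>2 \<le> (R ^ m)\<^sup>2"
    using r by (intro power_mono) auto
  then have "1 - 2 * R ^ m - (R ^ m)\<^sup>2 \<le> 1 - 2 * r ^ m - (r ^ m)\<^sup>2"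
    using r(3) by linarith
  ultimately have "(1 - R) * (1 - 2 * R ^ m - (R ^ m)\<^sup>2) \<le>
      (1 - r) * (1 - 2 * r ^ m - (r ^ m)\<^sup>2)"
    using r R by (intro mult_mono) auto
  moreover have "2 * r\<^sup>2 * (1 + r ^ m)\<^sup>2 \<le> 2 * R\<^sup>2 * (1 + R ^ m)\<^sup>2"
    using r R by (intro mult_mono power_mono) auto
  ultimately show ?thesis
    using \<open>2 * R\<^sup>2 * (1 + R ^ m)\<^sup>2 \<le> _\<close> by (simp add: phi_nonpos_iff)
qed

text \<open>A nonpositive value at r would, against the positive value at 1, force a root in [r, 1],
  beyond the greatest one.\<close>

lemma phi_pos:
  assumes "m \<ge> 1" "R_m1 m < r" "r < 1"
  shows "phi m r > 0"
proof (rule ccontr)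
  assume "\<not> phi m r > 0"
  moreover have "phi m 1 = 8"
    by (simp add: phi_def)
  moreover have "continuous_on {r..1} (phi m)"
    unfolding phi_def by (intro continuous_intros)
  ultimately have "\<exists>s\<ge>r. s \<le> 1 \<and> phi m s = 0"
    using assms by (intro IVT') auto
  then obtain s where "r \<le> s" "phi m s = 0"
    by blast
  then show False
    using R_m1_greatest_root(1)[OF assms(1)] R_m1_greatest_root(4)[OF assms(1), of s] assms
    by auto
qed

section \<open>The inequality and its sharpness\<close>

text \<open>The left-hand side is one minus the extremal value of the functional at \<rho> = r^m, with T the
  weight of the tail.\<close>

lemma bohr_defect_eq:
  fixes a \<rho> T :: real
  assumes "1 + a * \<rho> \<noteq> 0"
  shows "1 - (\<rho> + a) / (1 + a * \<rho>) - \<rho> * (1 - a\<^sup>2) / (1 + a * \<rho>)\<^sup>2 - (1 - a\<^sup>2) * T =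
    (1 - a) / (1 + a * \<rho>)\<^sup>2 * (1 - 2 * \<rho> - \<rho>\<^sup>2 * a - (1 + a) * (1 + a * \<rho>)\<^sup>2 * T)"
proof -
  define s where "s = 1 + a * \<rho>"
  have s: "s \<noteq> 0"
    using assms by (simp add: s_def)
  have "1 - (\<rho> + a) / s - \<rho> * (1 - a\<^sup>2) / s\<^sup>2 - (1 - a\<^sup>2) * T =
      ((s - (\<rho> + a)) * s - \<rho> * (1 - a\<^sup>2) - (1 - a\<^sup>2) * s\<^sup>2 * T) / s\<^sup>2"
    using s by (simp add: field_simps power2_eq_square)
  also have "(s - (\<rho> + a)) * s - \<rho> * (1 - a\<^sup>2) = (1 - a) * (1 - 2 * \<rho> - \<rho>\<^sup>2 * a)"
    by (simp add: s_def power2_eq_square algebra_simps)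
  also have "(1 - a) * (1 - 2 * \<rho> - \<rho>\<^sup>2 * a) - (1 - a\<^sup>2) * s\<^sup>2 * T =
      (1 - a) * (1 - 2 * \<rho> - \<rho>\<^sup>2 * a - (1 + a) * s\<^sup>2 * T)"
    by (simp add: power2_eq_square algebra_simps)
  finally show ?thesis
    by (simp only: s_def times_divide_eq_left)
qed

text \<open>The real-variable core: a, x and d stand for the moduli of f(0), f(z^m) and f'(z^m), and
  \<rho> for that of z^m. The link between \<rho> and r enters only through
  \<open>phi\<close>.\<close>

lemma bohr_real_inequality:
  fixes a \<rho> r x d :: real
  assumes a: "0 \<le> a" "a < 1" and \<rho>: "0 \<le> \<rho>" "\<rho> < 1" and r: "0 \<le> r" "r < 1"
    and x: "0 \<le> x" "x \<le> (\<rho> + a) / (1 + a * \<rho>)"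
    and d: "d * (1 - \<rho>\<^sup>2) \<le> 1 - x\<^sup>2"
    and phi: "2 * r\<^sup>2 * (1 + \<rho>)\<^sup>2 \<le> (1 - r) * (1 - 2 * \<rho> - \<rho>\<^sup>2)"
  shows "x + \<rho> * d + (1 - a\<^sup>2) * (r\<^sup>2 / (1 - r)) \<le> 1"
proof -
  define s X q T where "s = 1 + a * \<rho>" and "X = (\<rho> + a) / (1 + a * \<rho>)"
    and "q = \<rho> / (1 - \<rho>\<^sup>2)" and "T = r\<^sup>2 / (1 - r)"
  have s: "1 \<le> s" "s \<le> 1 + \<rho>"
    using a \<rho> by (auto simp: s_def mult_left_le_one_le)
  have \<rho>2: "0 < 1 - \<rho>\<^sup>2"
    using \<rho> by (simp add: abs_square_less_1)
  have "0 \<le> (1 - r) * (1 - 2 * \<rho> - \<rho>\<^sup>2)"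
    using phi by (rule order_trans[rotated]) simp
  then have "0 \<le> 1 - 2 * \<rho> - \<rho>\<^sup>2"
    using r by (simp add: zero_le_mult_iff)
  \<comment> \<open>The preceding sign says that 2 \<rho> is at most 1 - \<rho>^2.\<close>
  then have q: "0 \<le> q" "q \<le> 1 / 2"
    using \<rho> \<rho>2 by (auto simp: q_def field_simps)
  have "0 \<le> (1 - a) * (1 - \<rho>)"
    using a \<rho> by simp
  then have "X \<le> 1"
    using s by (simp add: X_def field_simps s_def)
  then have "q * (X + x) \<le> 1 / 2 * 2"
    using x q by (intro mult_mono) (auto simp: X_def)
  \<comment> \<open>This product is the increment of t + q (1 - t^2) from t = x to t = X.\<close>
  then have "0 \<le> (X - x) * (1 - q * (X + x))"
    using x by (intro mult_nonneg_nonneg) (auto simp: X_def)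
  then have mono: "x + q * (1 - x\<^sup>2) \<le> X + q * (1 - X\<^sup>2)"
    by (simp add: power2_eq_square algebra_simps)
  have "\<rho> * d = q * (d * (1 - \<rho>\<^sup>2))"
    using \<rho>2 by (simp add: q_def)
  also have "\<dots> \<le> q * (1 - x\<^sup>2)"
    using q d by (intro mult_left_mono) auto
  finally have "x + \<rho> * d \<le> X + q * (1 - X\<^sup>2)"
    using mono by simp
  also have "q * (1 - X\<^sup>2) = \<rho> * (1 - a\<^sup>2) / s\<^sup>2"
  proof -
    have "1 - X\<^sup>2 = (s\<^sup>2 - (\<rho> + a)\<^sup>2) / s\<^sup>2"
      using s by (simp add: X_def s_def[symmetric] power_divide diff_divide_distrib)
    also have "s\<^sup>2 - (\<rho> + a)\<^sup>2 = (1 - \<rho>\<^sup>2) * (1 - a\<^sup>2)"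
      by (simp add: s_def power2_eq_square algebra_simps)
    finally show ?thesis
      using \<rho>2 by (simp add: q_def)
  qed
  finally have le: "x + \<rho> * d \<le> X + \<rho> * (1 - a\<^sup>2) / s\<^sup>2" .
  have T: "0 \<le> T"
    using r by (simp add: T_def)
  \<comment> \<open>Every occurrence of a is now moved to its worst value 1, where
    \<open>phi\<close> applies.\<close>
  have "(1 + a) * s\<^sup>2 * T \<le> 2 * (1 + \<rho>)\<^sup>2 * T"
    using a s T by (intro mult_right_mono mult_mono power_mono) auto
  also have "\<dots> \<le> 1 - 2 * \<rho> - \<rho>\<^sup>2"
    using phi r by (simp add: T_def field_simps)
  also have "\<dots> \<le> 1 - 2 * \<rho> - \<rho>\<^sup>2 * a"
    using a by (simp add: mult_left_le)
  finally have "0 \<le> (1 - a) / s\<^sup>2 * (1 - 2 * \<rho> - \<rho>\<^sup>2 * a - (1 + a) * s\<^sup>2 * T)"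
    using a by simp
  also have "\<dots> = 1 - X - \<rho> * (1 - a\<^sup>2) / s\<^sup>2 - (1 - a\<^sup>2) * T"
    using bohr_defect_eq[of a \<rho> T] s by (simp add: X_def s_def)
  finally show ?thesis
    using le by (simp add: T_def)
qed

text \<open>The uniform coefficient bound leaves a geometric series starting at exponent 2, with sum
  r^2 / (1 - r).\<close>

lemma schur_class_tail_le:
  assumes f: "f \<in> schur_class" and a: "has_power_series f a" and r: "0 \<le> r" "r < 1"
  shows "(\<Sum>k. norm (a (k + 2)) * r ^ (k + 2)) \<le> (1 - (norm (a 0))\<^sup>2) * (r\<^sup>2 / (1 - r))"
proof -
  let ?c = "1 - (norm (a 0))\<^sup>2"
  have le: "norm (a (k + 2)) * r ^ (k + 2) \<le> ?c * (r\<^sup>2 * r ^ k)" for k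
  proof -
    have "norm (a (k + 2)) * r ^ (k + 2) \<le> ?c * r ^ (k + 2)"
      using r by (intro mult_right_mono schur_class_coeff_le[OF f a]) auto
    also have "?c * r ^ (k + 2) = ?c * (r\<^sup>2 * r ^ k)"
      by (simp add: power2_eq_square)
    finally show ?thesis .
  qed
  have "(\<lambda>k. r ^ k) sums (1 / (1 - r))"
    using r by (intro geometric_sums) simp
  then have sums: "(\<lambda>k. ?c * (r\<^sup>2 * r ^ k)) sums (?c * (r\<^sup>2 * (1 / (1 - r))))"
    by (intro sums_mult)
  have "summable (\<lambda>k. norm (a (k + 2)) * r ^ (k + 2))"
    by (rule summable_comparison_test'[OF sums_summable[OF sums], of 0])
      (use le r in \<open>auto simp: abs_mult\<close>)
  then have "(\<Sum>k. norm (a (k + 2)) * r ^ (k + 2)) \<le> (\<Sum>k. ?c * (r\<^sup>2 * r ^ k))"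
    using le sums by (intro suminf_le) (auto simp: sums_iff)
  then show ?thesis
    using sums by (simp add: sums_iff)
qed

lemma bohr_inequality:
  assumes "m \<ge> 1" and f: "f \<in> schur_class" and a: "has_power_series f a"
    and z: "norm z \<le> R_m1 m"
  shows "norm (f (z ^ m)) + norm (z ^ m) * norm (deriv f (z ^ m))
    + (\<Sum>k. norm (a (k + 2)) * norm z ^ (k + 2)) \<le> 1"
proof -
  have z1: "norm z < 1"
    using z R_m1_greatest_root(2)[OF assms(1)] by simp
  have w1: "norm (z ^ m) < 1"
    using z1 assms(1) by (simp add: norm_power power_less_one_iff)
  have a0: "f 0 = a 0"
    by (rule has_power_series_0[OF a])
  have "norm (f (z ^ m)) + norm (z ^ m) * norm (deriv f (z ^ m))
      + (1 - (norm (a 0))\<^sup>2) * ((norm z)\<^sup>2 / (1 - norm z)) \<le> 1"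
  proof (rule bohr_real_inequality)
    show "norm (a 0) < 1"
      using schur_class_norm_less[OF f, of 0] a0 by simp
    show "norm (f (z ^ m)) \<le> (norm (z ^ m) + norm (a 0)) / (1 + norm (a 0) * norm (z ^ m))"
      using schur_class_growth[OF f w1] a0 by simp
    show "norm (deriv f (z ^ m)) * (1 - (norm (z ^ m))\<^sup>2) \<le> 1 - (norm (f (z ^ m)))\<^sup>2"
      by (rule Schwarz_Pick_deriv[OF f w1])
    show "2 * (norm z)\<^sup>2 * (1 + norm (z ^ m))\<^sup>2 \<le>
        (1 - norm z) * (1 - 2 * norm (z ^ m) - (norm (z ^ m))\<^sup>2)"
      using phi_nonpos[OF assms(1) _ z] phi_nonpos_iff[of m "norm z"] by (simp add: norm_power)
  qed (use z1 w1 in auto)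
  then show ?thesis
    using schur_class_tail_le[OF f a _ z1] by simp
qed

section \<open>The extremal disc automorphisms\<close>

lemma Moebius_function_has_power_series:
  fixes a :: real
  assumes "0 \<le> a" "a < 1"
  shows "has_power_series (Moebius_function 0 (- of_real a))
    (\<lambda>k. case k of 0 \<Rightarrow> of_real a | Suc j \<Rightarrow> of_real ((1 - a\<^sup>2) * (- a) ^ j))"
  unfolding has_power_series_def
proof
  let ?c = "\<lambda>k. case k of 0 \<Rightarrow> of_real a | Suc j \<Rightarrow> complex_of_real ((1 - a\<^sup>2) * (- a) ^ j)"
  fix z :: complex
  assume "z \<in> ball 0 1"
  then have z: "norm z < 1"
    by simp
  have az: "norm (- of_real a * z) < 1"
    using norm_mult_less[of "- of_real a" 1 z 1] z assms by simp
  have nz: "1 + of_real a * z \<noteq> 0"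
    using one_minus_cnj_mult_nonzero[of "- of_real a" z] z assms by simp
  \<comment> \<open>The splitting (z + a) / (1 + a z) = a + (1 - a^2) z / (1 + a z) reduces the
    expansion to a geometric series with ratio -a z.\<close>
  have "(\<lambda>j. of_real (1 - a\<^sup>2) * z * (- of_real a * z) ^ j) sums
      (of_real (1 - a\<^sup>2) * z * (1 / (1 - (- of_real a * z))))"
    by (intro sums_mult geometric_sums az)
  moreover have "of_real (1 - a\<^sup>2) * z * (- of_real a * z) ^ j = ?c (Suc j) * z ^ Suc j" for j
    by (simp only: nat.case of_real_mult of_real_power of_real_minus power_mult_distrib power_Suc mult_ac)
  ultimately have "(\<lambda>j. ?c (Suc j) * z ^ Suc j) sums (of_real (1 - a\<^sup>2) * z / (1 + of_real a * z))"
    by (simp only: minus_mult_left[symmetric] diff_minus_eq_add times_divide_eq_right mult_1_right)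
  then have "(\<lambda>j. ?c j * z ^ j) sums
      (of_real (1 - a\<^sup>2) * z / (1 + of_real a * z) + ?c 0 * z ^ 0)"
    by (subst (asm) sums_Suc_iff) simp
  also have "of_real (1 - a\<^sup>2) * z / (1 + of_real a * z) + ?c 0 * z ^ 0 =
      Moebius_function 0 (- of_real a) z"
    using nz by (simp add: Moebius_function_simple field_simps power2_eq_square)
  finally show "(\<lambda>k. ?c k * z ^ k) sums Moebius_function 0 (- of_real a) z" .
qed

text \<open>For the automorphism with parameter a, the defect of the inequality is a positive factor
  times \<open>h a\<close>. Positivity of \<open>phi\<close> makes \<open>h\<close> negative at 1,
  hence also slightly to the left of 1.\<close>

lemma bohr_radius_sharp:
  assumes "m \<ge> 1" and r: "0 < r" "r < 1" and phi: "phi m r > 0"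
  shows "\<exists>f\<in>schur_class. \<exists>c. has_power_series f c \<and>
    norm (f (of_real r ^ m)) + norm (of_real r ^ m :: complex) * norm (deriv f (of_real r ^ m))
      + (\<Sum>k. norm (c (k + 2)) * r ^ (k + 2)) > 1"
proof -
  define \<rho> where "\<rho> = r ^ m"
  have \<rho>: "0 < \<rho>" "\<rho> < 1"
    using r assms(1) by (auto simp: \<rho>_def power_less_one_iff)
  \<comment> \<open>The coefficients have modulus (1 - a^2) a^(k-1) for k \<ge> 1, so the tail from
    k = 2 is (1 - a^2) times this weight.\<close>
  define T where "T a = a * r\<^sup>2 / (1 - a * r)" for a
  define h where "h a = 1 - 2 * \<rho> - \<rho>\<^sup>2 * a - (1 + a) * (1 + a * \<rho>)\<^sup>2 * T a" for a
  have "(1 - r) * (1 - 2 * \<rho> - \<rho>\<^sup>2) < 2 * r\<^sup>2 * (1 + \<rho>)\<^sup>2"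
    using phi phi_nonpos_iff[of m r] by (simp add: \<rho>_def)
  \<comment> \<open>Here T 1 = r^2 / (1 - r), and \<open>h 1\<close> equals -phi m r / (1 -
    r).\<close>
  then have "h 1 < 0"
    using r by (simp add: h_def T_def field_simps)
  moreover have "isCont h 1"
    unfolding h_def T_def using r by (intro continuous_intros) auto
  then have "(h \<longlongrightarrow> h 1) (at_left 1)"
    by (simp add: isCont_def filterlim_at_split)
  \<comment> \<open>The parameter 1 itself would give the constant function 1, so a value just below
    it is taken by continuity.\<close>
  ultimately have "eventually (\<lambda>a. h a < 0) (at_left 1)"
    by (auto intro: order_tendstoD)
  moreover have "eventually (\<lambda>a::real. a \<in> {0<..<1}) (at_left 1)"
    by (rule eventually_at_left_real) simp
  ultimately have "eventually (\<lambda>a. h a < 0 \<and> a \<in> {0<..<1}) (at_left 1)"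
    by eventually_elim simp
  then obtain a where a: "h a < 0" "0 < a" "a < 1"
    using eventually_happens'[OF trivial_limit_at_left_real] by fastforce
  define f where "f = Moebius_function 0 (- of_real a)"
  define c where "c = (\<lambda>k. case k of 0 \<Rightarrow> of_real a
    | Suc j \<Rightarrow> complex_of_real ((1 - a\<^sup>2) * (- a) ^ j))"
  have a2: "0 < 1 - a\<^sup>2"
    using a by (simp add: abs_square_less_1)
  have s: "0 < 1 + a * \<rho>"
    using a \<rho> by (simp add: add_pos_pos)
  \<comment> \<open>At a positive real point \<open>f\<close> and its derivative are positive, so
    taking norms loses nothing.\<close>
  have "f (of_real \<rho>) = of_real ((\<rho> + a) / (1 + a * \<rho>))"
    by (simp add: f_def Moebius_function_simple)
  then have f\<rho>: "norm (f (of_real \<rho>)) = (\<rho> + a) / (1 + a * \<rho>)"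
    using s a \<rho> by (simp del: of_real_divide of_real_add)
  have "deriv f (of_real \<rho>) = of_real ((1 - a\<^sup>2) / (1 + a * \<rho>)\<^sup>2)"
    unfolding f_def
    using DERIV_imp_deriv[OF Moebius_function_has_field_derivative[of "- of_real a" "of_real \<rho>"]]
      a \<rho> by simp
  then have f'\<rho>: "norm (deriv f (of_real \<rho>)) = (1 - a\<^sup>2) / (1 + a * \<rho>)\<^sup>2"
    using s a2 by (simp del: of_real_divide of_real_diff of_real_power)
  have "a * r < 1"
    using mult_strict_mono[of a 1 r 1] a r by simp
  then have "(\<lambda>k. (1 - a\<^sup>2) * (a * r\<^sup>2) * (a * r) ^ k) sums
      ((1 - a\<^sup>2) * (a * r\<^sup>2) * (1 / (1 - a * r)))"
    using a r by (intro sums_mult geometric_sums) simp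
  moreover have "norm (c (k + 2)) * r ^ (k + 2) = (1 - a\<^sup>2) * (a * r\<^sup>2) * (a * r) ^ k" for k
  proof -
    have "norm (c (k + 2)) = \<bar>(1 - a\<^sup>2) * (- a) ^ Suc k\<bar>"
      by (simp add: c_def del: of_real_mult of_real_power of_real_diff of_real_minus power_Suc)
    also have "\<dots> = (1 - a\<^sup>2) * a ^ Suc k"
      using a a2 by (simp add: abs_mult power_abs)
    finally show ?thesis
      by (simp add: power_mult_distrib power_add power2_eq_square mult_ac)
  qed
  ultimately have tail: "(\<Sum>k. norm (c (k + 2)) * r ^ (k + 2)) = (1 - a\<^sup>2) * T a"
    by (simp add: sums_iff T_def)
  have "(1 - a) / (1 + a * \<rho>)\<^sup>2 * h a < 0"
    using a s by (intro mult_pos_neg) auto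
  then have "(\<rho> + a) / (1 + a * \<rho>) + \<rho> * ((1 - a\<^sup>2) / (1 + a * \<rho>)\<^sup>2) + (1 - a\<^sup>2) * T a > 1"
    using bohr_defect_eq[of a \<rho> "T a"] s by (simp add: h_def)
  then have "norm (f (of_real \<rho>)) + \<rho> * norm (deriv f (of_real \<rho>))
      + (\<Sum>k. norm (c (k + 2)) * r ^ (k + 2)) > 1"
    by (simp only: f\<rho> f'\<rho> tail)
  moreover have "of_real r ^ m = complex_of_real \<rho>" "norm (complex_of_real \<rho>) = \<rho>"
    using \<rho>(1) by (simp add: \<rho>_def, simp only: norm_of_real abs_of_pos)
  moreover have "f \<in> schur_class"
    unfolding f_def using a by (intro schur_class_Moebius_function) simp
  moreover have "has_power_series f c"
    unfolding f_def c_def using a by (intro Moebius_function_has_power_series) auto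
  ultimately show ?thesis
    by (intro bexI[of _ f] exI[of _ c]) auto
qed

theorem theorem2:
  fixes m :: nat
  assumes "m \<ge> 1"
  shows "(\<forall>f\<in>schur_class. \<forall>a. has_power_series f a \<longrightarrow>
            (\<forall>z\<in>ball 0 1. \<forall>r. norm z = r \<and> r \<le> R_m1 m \<longrightarrow>
               norm (f (z ^ m)) + norm (z ^ m) * norm (deriv f (z ^ m))
                 + (\<Sum>k. norm (a (k + 2)) * r ^ (k + 2)) \<le> 1)) \<and>
         (\<forall>R'. R_m1 m < R' \<and> R' < 1 \<longrightarrow>
            (\<exists>f\<in>schur_class. \<exists>a z r. has_power_series f a \<and> norm z = r \<and> r \<le> R' \<and>
               norm (f (z ^ m)) + norm (z ^ m) * norm (deriv f (z ^ m))
                 + (\<Sum>k. norm (a (k + 2)) * r ^ (k + 2)) > 1))"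
proof (intro conjI ballI allI impI; (elim conjE)?)
  fix f a z r
  assume "f \<in> schur_class" "has_power_series f a" "norm (z :: complex) = r" "r \<le> R_m1 m"
  then show "norm (f (z ^ m)) + norm (z ^ m) * norm (deriv f (z ^ m))
      + (\<Sum>k. norm (a (k + 2)) * r ^ (k + 2)) \<le> 1"
    using bohr_inequality[OF assms, of f a z] by simp
next
  fix R'
  assume R': "R_m1 m < R'" "R' < 1"
  then have pos: "0 < R'"
    using R_m1_greatest_root(1)[OF assms] by simp
  \<comment> \<open>The violation is found at the radius R' itself, at the real point z =
    R'.\<close>
  obtain f c where "f \<in> schur_class" "has_power_series f c"
    "norm (f (of_real R' ^ m)) + norm (of_real R' ^ m :: complex) * norm (deriv f (of_real R' ^ m))
      + (\<Sum>k. norm (c (k + 2)) * R' ^ (k + 2)) > 1"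
    using bohr_radius_sharp[OF assms pos R'(2) phi_pos[OF assms R']] by blast
  then show "\<exists>f\<in>schur_class. \<exists>a z r. has_power_series f a \<and> norm z = r \<and> r \<le> R' \<and>
      norm (f (z ^ m)) + norm (z ^ m) * norm (deriv f (z ^ m))
        + (\<Sum>k. norm (a (k + 2)) * r ^ (k + 2)) > 1"
    using pos by (intro bexI[of _ f] exI[of _ c] exI[of _ "of_real R'"] exI[of _ R'] conjI) auto
qed

end
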